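(* Let $G$ be a finite simple connected graph with $m>0$ edges, maximum degree $\Delta$ and minimum degree $\delta\ge 1$. Then $$DSO(G) \le m\,\frac{\sqrt{\Delta^{2}+\delta^{2}}}{\Delta+\delta}.$$ Equality holds if and only if $G$ is either regular or bipartite semiregular with part degrees $\Delta$ and $\delta$.
   Context: For a finite simple graph $G=(V(G),E(G))$, $d_u$ denotes the degree of the vertex $u$. The Diminished Sombor index is $DSO(G)=\sum_{uv\in E(G)}\frac{\sqrt{d_u^2+d_v^2}}{d_u+d_v}$. A graph is bipartite semiregular with part degrees $r$ and $s$ if it is bipartite with a bipartition $(A,B)$ such that every vertex of $A$ has degree $r$ and every vertex of $B$ has degree $s$. *)

theory Defs
  imports Complex_Main "Graph_Theory.Digraph_Component" "Graph_Theory.Pair_Digraph"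
begin

text \<open>
  A finite simple graph is a \<^locale>\<open>pair_graph\<close>: a finite loop-free symmetric digraph whose arcs
  are pairs of vertices. Each undirected edge is represented by two arcs, so that the
  degree of a vertex is its out-degree, while edges have to be counted as two-element sets.
\<close>

definition edges :: "'a pair_pre_digraph \<Rightarrow> 'a set set" where
  "edges G = {{u, v} | u v. (u, v) \<in> parcs G}"

abbreviation degree :: "'a pair_pre_digraph \<Rightarrow> 'a \<Rightarrow> nat" where
  "degree G v \<equiv> out_degree (with_proj G) v"

definition max_degree :: "'a pair_pre_digraph \<Rightarrow> nat" where
  "max_degree G = Max (degree G ` pverts G)"

definition min_degree :: "'a pair_pre_digraph \<Rightarrow> nat" where
  "min_degree G = Min (degree G ` pverts G)"

text \<open>
  The inner sums run over the two end vertices of the edge \<open>e\<close>; lemma \<open>DSO_summand\<close> below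
  gives the summand in terms of the end vertices.
\<close>

definition DSO :: "'a pair_pre_digraph \<Rightarrow> real" where
  "DSO G = (\<Sum>e\<in>edges G.
     sqrt (\<Sum>w\<in>e. (real (degree G w))\<^sup>2) / (\<Sum>w\<in>e. real (degree G w)))"

lemma (in pair_graph) DSO_summand:
  assumes "(u, v) \<in> parcs G"
  shows "sqrt (\<Sum>w\<in>{u, v}. (real (degree G w))\<^sup>2) / (\<Sum>w\<in>{u, v}. real (degree G w))
       = sqrt ((real (degree G u))\<^sup>2 + (real (degree G v))\<^sup>2) / (real (degree G u) + real (degree G v))"
proof -
  have "u \<noteq> v" using pair_no_loops[OF assms] by simp
  then show ?thesis by simp
qed

definition regular :: "'a pair_pre_digraph \<Rightarrow> bool" where
  "regular G \<longleftrightarrow> (\<exists>r. \<forall>v\<in>pverts G. degree G v = r)"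

definition bipartition :: "'a pair_pre_digraph \<Rightarrow> 'a set \<Rightarrow> 'a set \<Rightarrow> bool" where
  "bipartition G A B \<longleftrightarrow> A \<union> B = pverts G \<and> A \<inter> B = {} \<and>
     (\<forall>(u, v)\<in>parcs G. u \<in> A \<and> v \<in> B \<or> u \<in> B \<and> v \<in> A)"

definition bipartite_semiregular :: "'a pair_pre_digraph \<Rightarrow> nat \<Rightarrow> nat \<Rightarrow> bool" where
  "bipartite_semiregular G r s \<longleftrightarrow> (\<exists>A B. bipartition G A B \<and>
     (\<forall>v\<in>A. degree G v = r) \<and> (\<forall>v\<in>B. degree G v = s))"

end

theory Submission
  imports Defs
begin

text \<open>
  Everything rests on the identity
  \[
    (D^2 + d^2)(a + b)^2 - (a^2 + b^2)(D + d)^2 = 2\,(aD - bd)(bD - ad).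
  \]
  If $0 < d \le a, b \le D$, then $aD \ge dD \ge bd$, and likewise $bD \ge ad$, so the right-hand
  side is nonnegative. It vanishes only if one of these two chains is a chain of equalities, that
  is, only if $\{a, b\} = \{d, D\}$. Hence each edge contributes at most
  $\sqrt{\Delta^2 + \delta^2} / (\Delta + \delta)$ to the index, with equality exactly if its ends
  have degrees $\Delta$ and $\delta$ (lemmas \<open>sqrt_sum_squares_ratio_le\<close> and
  \<open>sqrt_sum_squares_ratio_eq_iff\<close>). Summing over the edges gives the bound.

  Equality in the bound thus means that every edge joins a vertex of degree $\Delta$ to one of
  degree $\delta$. Since $\delta \ge 1$, every vertex lies on an edge and so has one of these two
  degrees. If they coincide, the graph is regular, and otherwise the two degree classes form
  the required bipartition. Conversely, in a regular graph every degree equals both $\Delta$ and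
  $\delta$, and in a semiregular one each edge crosses between the parts (lemma \<open>edge_degrees_extremal_iff\<close>).
\<close>

section \<open>The contribution of one edge\<close>

lemma sum_squares_cross_identity:
  fixes a b d D :: real
  shows "(D\<^sup>2 + d\<^sup>2) * (a + b)\<^sup>2 - (a\<^sup>2 + b\<^sup>2) * (D + d)\<^sup>2 = 2 * ((a * D - b * d) * (b * D - a * d))"
  by (simp add: power2_eq_square algebra_simps)

text \<open>
  The ratio is the square root of $(a^2 + b^2) / (a + b)^2$, so that comparing two ratios
  amounts to comparing the two products in the identity above.
\<close>

lemma sqrt_sum_squares_ratio_conv:
  fixes a b :: real
  assumes "a > 0" "b > 0"
  shows "sqrt (a\<^sup>2 + b\<^sup>2) / (a + b) = sqrt ((a\<^sup>2 + b\<^sup>2) / (a + b)\<^sup>2)"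
  using assms by (simp add: real_sqrt_divide)

lemma sqrt_sum_squares_ratio_le:
  fixes a b d D :: real
  assumes "0 < d" "d \<le> a" "a \<le> D" "d \<le> b" "b \<le> D"
  shows "sqrt (a\<^sup>2 + b\<^sup>2) / (a + b) \<le> sqrt (D\<^sup>2 + d\<^sup>2) / (D + d)"
proof -
  have pos: "a > 0" "b > 0" "D > 0" using assms by auto
  have "b * d \<le> a * D" "a * d \<le> b * D"
    using mult_mono[of d a b D] mult_mono[of d b a D] assms pos by (simp_all add: mult.commute)
  then have "0 \<le> (a * D - b * d) * (b * D - a * d)" by simp
  then have "(a\<^sup>2 + b\<^sup>2) * (D + d)\<^sup>2 \<le> (D\<^sup>2 + d\<^sup>2) * (a + b)\<^sup>2"
    using sum_squares_cross_identity[of D d a b] by linarith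
  then have "(a\<^sup>2 + b\<^sup>2) / (a + b)\<^sup>2 \<le> (D\<^sup>2 + d\<^sup>2) / (D + d)\<^sup>2"
    using pos assms(1) by (simp add: divide_le_eq le_divide_eq)
  then show ?thesis
    using pos assms(1) by (simp only: sqrt_sum_squares_ratio_conv real_sqrt_le_iff)
qed

text \<open>The product $dD$ lies between the two sides, so equality pinches it.\<close>

lemma mult_eq_extremal_iff:
  fixes a b d D :: real
  assumes "0 < d" "d \<le> a" "b \<le> D" "0 < D"
  shows "a * D = b * d \<longleftrightarrow> a = d \<and> b = D"
proof
  assume eq: "a * D = b * d"
  have "d * D \<le> a * D" "b * d \<le> D * d" using assms by auto
  with eq have "a * D = d * D" "b * d = D * d" by (auto simp: mult.commute)
  with assms show "a = d \<and> b = D" by auto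
qed auto

lemma sqrt_sum_squares_ratio_eq_iff:
  fixes a b d D :: real
  assumes "0 < d" "d \<le> a" "a \<le> D" "d \<le> b" "b \<le> D"
  shows "sqrt (a\<^sup>2 + b\<^sup>2) / (a + b) = sqrt (D\<^sup>2 + d\<^sup>2) / (D + d)
    \<longleftrightarrow> a = D \<and> b = d \<or> a = d \<and> b = D"
proof -
  have pos: "a > 0" "b > 0" "D > 0" using assms by auto
  have "sqrt (a\<^sup>2 + b\<^sup>2) / (a + b) = sqrt (D\<^sup>2 + d\<^sup>2) / (D + d)
    \<longleftrightarrow> (a\<^sup>2 + b\<^sup>2) / (a + b)\<^sup>2 = (D\<^sup>2 + d\<^sup>2) / (D + d)\<^sup>2"
    using pos assms(1) by (simp only: sqrt_sum_squares_ratio_conv real_sqrt_eq_iff)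
  also have "\<dots> \<longleftrightarrow> (a\<^sup>2 + b\<^sup>2) * (D + d)\<^sup>2 = (D\<^sup>2 + d\<^sup>2) * (a + b)\<^sup>2"
    using pos assms(1) by (intro frac_eq_eq) auto
  also have "\<dots> \<longleftrightarrow> (a * D - b * d) * (b * D - a * d) = 0"
    using sum_squares_cross_identity[of D d a b] by linarith
  also have "\<dots> \<longleftrightarrow> a * D = b * d \<or> b * D = a * d" by simp
  also have "\<dots> \<longleftrightarrow> a = D \<and> b = d \<or> a = d \<and> b = D"
    using mult_eq_extremal_iff[of d a b D] mult_eq_extremal_iff[of d b a D] assms pos by auto
  finally show ?thesis .
qed

section \<open>Degrees and edges of a finite simple graph\<close>

context pair_graph
begin

lemma finite_edges: "finite (edges G)"
proof -
  have "edges G = (\<lambda>(u, v). {u, v}) ` parcs G" by (auto simp: edges_def)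
  then show ?thesis by simp
qed

lemma degree_le_max_degree: "v \<in> pverts G \<Longrightarrow> degree G v \<le> max_degree G"
  unfolding max_degree_def by (intro Max_ge) auto

lemma min_degree_le_degree: "v \<in> pverts G \<Longrightarrow> min_degree G \<le> degree G v"
  unfolding min_degree_def by (intro Min_le) auto

lemma degree_pos_imp_arc:
  assumes "degree G v > 0"
  obtains w where "(v, w) \<in> parcs G"
proof -
  have "out_arcs (with_proj G) v \<noteq> {}"
    using assms by (auto simp: out_degree_def)
  then show thesis using that by (auto simp: out_arcs_def)
qed

lemma regular_imp_degree_extremal:
  assumes "regular G" "v \<in> pverts G"
  shows "degree G v = max_degree G" "degree G v = min_degree G"
proof -
  obtain r where "\<forall>u\<in>pverts G. degree G u = r" using assms(1) by (auto simp: regular_def)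
  then have "degree G ` pverts G = {degree G v}" using assms(2) by auto
  then show "degree G v = max_degree G" "degree G v = min_degree G"
    by (simp_all add: max_degree_def min_degree_def)
qed

text \<open>
  This local condition on edges suffices to determine the global shape of the graph because a
  positive minimum degree leaves no vertex off the edges: the set of vertices of degree $\Delta$
  and the set of those of degree $\delta$ cover the graph, and an edge never stays inside one of
  them unless they coincide.
\<close>

lemma edge_degrees_extremal_iff:
  assumes "min_degree G \<ge> 1"
  shows "(\<forall>(u, v)\<in>parcs G. degree G u = max_degree G \<and> degree G v = min_degree G
            \<or> degree G u = min_degree G \<and> degree G v = max_degree G)
    \<longleftrightarrow> regular G \<or> bipartite_semiregular G (max_degree G) (min_degree G)"
    (is "?extremal \<longleftrightarrow> ?shape")
proof
  assume ext: ?extremal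
  have cover: "degree G v = max_degree G \<or> degree G v = min_degree G" if v: "v \<in> pverts G" for v
  proof -
    have "degree G v > 0" using min_degree_le_degree[OF v] assms by simp
    then obtain w where "(v, w) \<in> parcs G" by (rule degree_pos_imp_arc)
    with ext show ?thesis by fastforce
  qed
  show ?shape
  proof (cases "max_degree G = min_degree G")
    case True
    with cover show ?thesis by (auto simp: regular_def)
  next
    case False
    define A where "A = {v \<in> pverts G. degree G v = max_degree G}"
    define B where "B = {v \<in> pverts G. degree G v = min_degree G}"
    have "u \<in> A \<and> v \<in> B \<or> u \<in> B \<and> v \<in> A" if "(u, v) \<in> parcs G" for u v
    proof -
      have "u \<in> pverts G" "v \<in> pverts G" using that by (auto dest: in_arcsD1 in_arcsD2)
      with that ext show ?thesis by (fastforce simp: A_def B_def)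
    qed
    moreover have "A \<union> B = pverts G" "A \<inter> B = {}"
      using cover False by (auto simp: A_def B_def)
    ultimately have "bipartition G A B" by (auto simp: bipartition_def)
    then have "bipartite_semiregular G (max_degree G) (min_degree G)"
      unfolding bipartite_semiregular_def by (intro exI[of _ A] exI[of _ B]) (auto simp: A_def B_def)
    then show ?thesis ..
  qed
next
  assume ?shape
  then show ?extremal
  proof
    assume reg: "regular G"
    show ?extremal
    proof clarify
      fix u v assume "(u, v) \<in> parcs G"
      then have "u \<in> pverts G" "v \<in> pverts G" by (auto dest: in_arcsD1 in_arcsD2)
      then show "degree G u = max_degree G \<and> degree G v = min_degree G"
        using regular_imp_degree_extremal[OF reg] by blast
    qed
  next
    assume "bipartite_semiregular G (max_degree G) (min_degree G)"
    then show ?extremal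
      by (fastforce simp: bipartite_semiregular_def bipartition_def)
  qed
qed

end

section \<open>The bound on the Diminished Sombor index\<close>

theorem theorem1:
  fixes G :: "'a pair_pre_digraph" and m \<Delta> \<delta> :: nat
  assumes "pair_graph G"
    and "Digraph_Component.connected (with_proj G)"
    and "m = card (edges G)" and "m > 0"
    and "\<Delta> = max_degree G"
    and "\<delta> = min_degree G" and "\<delta> \<ge> 1"
  shows "DSO G \<le> real m * (sqrt ((real \<Delta>)\<^sup>2 + (real \<delta>)\<^sup>2) / (real \<Delta> + real \<delta>))
    \<and> (DSO G = real m * (sqrt ((real \<Delta>)\<^sup>2 + (real \<delta>)\<^sup>2) / (real \<Delta> + real \<delta>))
        \<longleftrightarrow> regular G \<or> bipartite_semiregular G \<Delta> \<delta>)"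
proof -
  interpret pair_graph G by fact
  define f where
    "f e = sqrt (\<Sum>w\<in>e. (real (degree G w))\<^sup>2) / (\<Sum>w\<in>e. real (degree G w))" for e
  define K where "K = sqrt ((real \<Delta>)\<^sup>2 + (real \<delta>)\<^sup>2) / (real \<Delta> + real \<delta>)"
  have f_arc: "f {u, v} \<le> K"
      "f {u, v} = K \<longleftrightarrow> degree G u = \<Delta> \<and> degree G v = \<delta> \<or> degree G u = \<delta> \<and> degree G v = \<Delta>"
    if "(u, v) \<in> parcs G" for u v
  proof -
    have "u \<in> pverts G" "v \<in> pverts G" using that by (auto dest: in_arcsD1 in_arcsD2)
    then have bounds: "0 < real \<delta>" "real \<delta> \<le> real (degree G u)" "real (degree G u) \<le> real \<Delta>"
        "real \<delta> \<le> real (degree G v)" "real (degree G v) \<le> real \<Delta>"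
      unfolding assms(5,6) of_nat_le_iff of_nat_0_less_iff
      using assms(6,7) by (auto intro: degree_le_max_degree min_degree_le_degree)
    show "f {u, v} \<le> K"
      using sqrt_sum_squares_ratio_le[OF bounds] unfolding f_def K_def DSO_summand[OF that] .
    show "f {u, v} = K \<longleftrightarrow>
        degree G u = \<Delta> \<and> degree G v = \<delta> \<or> degree G u = \<delta> \<and> degree G v = \<Delta>"
      using sqrt_sum_squares_ratio_eq_iff[OF bounds]
      unfolding f_def K_def DSO_summand[OF that] of_nat_eq_iff .
  qed
  have DSO_f: "DSO G = sum f (edges G)" by (simp add: DSO_def f_def)
  have mK: "real m * K = (\<Sum>e\<in>edges G. K)" by (simp add: assms(3))
  have f_le: "f e \<le> K" if "e \<in> edges G" for e using that f_arc(1) by (auto simp: edges_def)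
  have "DSO G \<le> real m * K" unfolding DSO_f mK by (rule sum_mono) (rule f_le)
  moreover have "DSO G = real m * K \<longleftrightarrow> regular G \<or> bipartite_semiregular G \<Delta> \<delta>"
  proof -
    have "DSO G = real m * K \<longleftrightarrow> (\<forall>e\<in>edges G. f e = K)"
      unfolding DSO_f mK using sum_mono_inv[of f "edges G" "\<lambda>_. K"] f_le finite_edges by auto
    also have "\<dots> \<longleftrightarrow> (\<forall>(u, v)\<in>parcs G. f {u, v} = K)"
      unfolding edges_def by blast
    also have "\<dots> \<longleftrightarrow> (\<forall>(u, v)\<in>parcs G. degree G u = \<Delta> \<and> degree G v = \<delta>
        \<or> degree G u = \<delta> \<and> degree G v = \<Delta>)"
      by (intro ball_cong refl) (simp add: f_arc(2) split_beta)
    also have "\<dots> \<longleftrightarrow> regular G \<or> bipartite_semiregular G \<Delta> \<delta>"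
      unfolding assms(5,6) using assms(6,7) by (intro edge_degrees_extremal_iff) simp
    finally show ?thesis .
  qed
  ultimately show ?thesis unfolding K_def by blast
qed

end
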